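(* Let $K$ be a simplicial complex on $[m]$, and let $N(K)$ be the set of its minimal non-simplices. Then: 1. $s(K)\geqslant 1$ if and only if $N(K)\neq\varnothing$, i.e. $K$ is not the full simplex on $[m]$. 2. $s(K)\geqslant 2$ if and only if $N(K)$ contains a subset of one of the following forms (in each form the listed elements $\tau_i$ are pairwise distinct): (i) $\{\tau_1,\tau_2,\tau_3\}$ with $\tau_1\cap\tau_2\cap\tau_3=\varnothing$; (ii) $\{\tau_1,\tau_2\}$ with $\tau_1\cap\tau_2=\varnothing$. 3. $s(K)\geqslant 3$ if and only if $N(K)$ contains a subset of one of the following forms (in each form the listed elements $\tau_i$ are pairwise distinct): (i) $\{\tau_1,\dots,\tau_7\}$ with $\tau_1\cap\tau_2\cap\tau_4=\varnothing$, $\tau_1\cap\tau_3\cap\tau_5=\varnothing$, $\tau_1\cap\tau_6\cap\tau_7=\varnothing$, $\tau_2\cap\tau_3\cap\tau_6=\varnothing$, $\tau_2\cap\tau_5\cap\tau_7=\varnothing$, $\tau_3\cap\tau_4\cap\tau_7=\varnothing$, $\tau_4\cap\tau_5\cap\tau_6=\varnothing$; (ii) $\{\tau_1,\dots,\tau_6\}$ with $\tau_1\cap\tau_3=\varnothing$, $\tau_1\cap\tau_2\cap\tau_4=\varnothing$, $\tau_1\cap\tau_2\cap\tau_5=\varnothing$, $\tau_1\cap\tau_4\cap\tau_6=\varnothing$, $\tau_1\cap\tau_5\cap\tau_6=\varnothing$, $\tau_2\cap\tau_3\cap\tau_6=\varnothing$, $\tau_3\cap\tau_4\cap\tau_5=\varnothing$;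 (iii) $\{\tau_1,\dots,\tau_5\}$ with $\tau_1\cap\tau_2=\varnothing$, $\tau_1\cap\tau_5=\varnothing$, $\tau_1\cap\tau_3\cap\tau_4=\varnothing$, $\tau_2\cap\tau_3\cap\tau_5=\varnothing$, $\tau_2\cap\tau_4\cap\tau_5=\varnothing$; (iv) $\{\tau_1,\dots,\tau_4\}$ with $\tau_1\cap(\tau_2\cup\tau_3\cup\tau_4)=\varnothing$ and $\tau_2\cap\tau_3\cap\tau_4=\varnothing$; (v) $\{\tau_1,\tau_2,\tau_3\}$ with $\tau_1\cap\tau_2=\tau_1\cap\tau_3=\tau_2\cap\tau_3=\varnothing$.
   Context: A simplicial complex $K$ on $[m]=\{1,\dots,m\}$ is a nonempty family of subsets of $[m]$ (called simplices) closed under taking subsets; in particular $\varnothing\in K$. A non-simplex is a set $\omega\subseteq[m]$ with $\omega\notin K$; it is minimal if every proper subset of $\omega$ belongs to $K$. $N(K)$ denotes the set of all minimal non-simplices of $K$. Let $D^2=\{z\in\mathbb C: |z|\leqslant 1\}$ and $S^1=\{z\in\mathbb C: |z|=1\}$. The moment-angle complex is $\mathcal Z_K=\{(x_1,\dots,x_m)\in (D^2)^m: \{i: x_i\notin S^1\}\in K\}$. The torus $T^m=(S^1)^m$ acts on $\mathcal Z_K$ by coordinatewise multiplication. The Buchstaber invariant $s(K)$ is the maximal dimension $s$ of a toric subgroup $H\subset T^m$, $H\simeq T^s$ (a closed subgroup isomorphic to a torus of dimension $s$), that acts freely on $\mathcal Z_K$. *)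

theory Defs
  imports "HOL-Analysis.Analysis" "HOL-Algebra.Product_Groups"
begin

definition abstract_simplicial_complex :: "nat \<Rightarrow> nat set set \<Rightarrow> bool" where
  "abstract_simplicial_complex m K \<longleftrightarrow>
     K \<noteq> {} \<and> K \<subseteq> Pow {1..m} \<and> (\<forall>\<sigma>\<in>K. \<forall>\<tau>. \<tau> \<subseteq> \<sigma> \<longrightarrow> \<tau> \<in> K)"

definition min_nonsimplices :: "nat \<Rightarrow> nat set set \<Rightarrow> nat set set" where
  "min_nonsimplices m K =
     {\<omega>. \<omega> \<subseteq> {1..m} \<and> \<omega> \<notin> K \<and> (\<forall>\<sigma>. \<sigma> \<subset> \<omega> \<longrightarrow> \<sigma> \<in> K)}"

text \<open>A point of \<open>\<complex>\<^sup>m\<close> is a function on \<open>{1..m}\<close> that is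
  \<open>undefined\<close> elsewhere, as in \<^const>\<open>PiE\<close>, \<^const>\<open>product_topology\<close>
  and \<^const>\<open>product_group\<close>. For \<open>m = 0\<close> the torus is the trivial group.\<close>

definition circle_group :: "complex monoid" where
  "circle_group = \<lparr>carrier = sphere 0 1, monoid.mult = (*), one = 1\<rparr>"

definition torus_group :: "nat \<Rightarrow> (nat \<Rightarrow> complex) monoid" where
  "torus_group m = product_group {1..m} (\<lambda>_. circle_group)"

definition torus_topology :: "nat \<Rightarrow> (nat \<Rightarrow> complex) topology" where
  "torus_topology m = product_topology (\<lambda>_. top_of_set (sphere 0 1)) {1..m}"

definition moment_angle_complex :: "nat \<Rightarrow> nat set set \<Rightarrow> (nat \<Rightarrow> complex) set" where
  "moment_angle_complex m K =
     {x \<in> PiE {1..m} (\<lambda>_. cball 0 1). {i \<in> {1..m}. x i \<notin> sphere 0 1} \<in> K}"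

definition torus_action :: "nat \<Rightarrow> (nat \<Rightarrow> complex) \<Rightarrow> (nat \<Rightarrow> complex) \<Rightarrow> (nat \<Rightarrow> complex)" where
  "torus_action m t x = (\<lambda>i\<in>{1..m}. t i * x i)"

definition acts_freely :: "nat \<Rightarrow> (nat \<Rightarrow> complex) set \<Rightarrow> (nat \<Rightarrow> complex) set \<Rightarrow> bool" where
  "acts_freely m H Z \<longleftrightarrow>
     (\<forall>t\<in>H. \<forall>x\<in>Z. torus_action m t x = x \<longrightarrow> t = \<one>\<^bsub>torus_group m\<^esub>)"

text \<open>Closed subgroups of the \<open>m\<close>-torus that are isomorphic, as topological groups,
  to the \<open>s\<close>-torus.\<close>

definition toric_subgroup :: "nat \<Rightarrow> nat \<Rightarrow> (nat \<Rightarrow> complex) set \<Rightarrow> bool" where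
  "toric_subgroup m s H \<longleftrightarrow>
     subgroup H (torus_group m) \<and> closedin (torus_topology m) H \<and>
     (\<exists>\<phi> \<in> iso (torus_group s) (torus_group m\<lparr>carrier := H\<rparr>).
        homeomorphic_map (torus_topology s) (subtopology (torus_topology m) H) \<phi>)"

definition free_toric_dims :: "nat \<Rightarrow> nat set set \<Rightarrow> nat set" where
  "free_toric_dims m K =
     {s. \<exists>H. toric_subgroup m s H \<and> acts_freely m H (moment_angle_complex m K)}"

lemma group_circle_group: "group circle_group"
proof (rule groupI)
  fix x assume "x \<in> carrier circle_group"
  then show "\<exists>y\<in>carrier circle_group. y \<otimes>\<^bsub>circle_group\<^esub> x = \<one>\<^bsub>circle_group\<^esub>"
    by (intro bexI[of _ "inverse x"]) (auto simp: circle_group_def norm_inverse intro!: left_inverse)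
qed (auto simp: circle_group_def norm_mult)

lemma group_torus_group: "group (torus_group m)"
  by (simp add: torus_group_def group_circle_group)

lemma torus_action_moment_angle_complex:
  assumes "t \<in> carrier (torus_group m)" "x \<in> moment_angle_complex m K"
  shows "torus_action m t x \<in> moment_angle_complex m K"
proof -
  have t: "norm (t i) = 1" if "i \<in> {1..m}" for i
    using assms(1) that by (auto simp: torus_group_def circle_group_def PiE_iff)
  have "{i \<in> {1..m}. torus_action m t x i \<notin> sphere 0 1} = {i \<in> {1..m}. x i \<notin> sphere 0 1}"
    using t by (auto simp: torus_action_def norm_mult)
  with assms(2) t show ?thesis
    by (auto simp: moment_angle_complex_def torus_action_def norm_mult PiE_iff)
qed

text \<open>The two lemmas below show that the maximum defining \<open>s(K)\<close> exists: the trivial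
  subgroup acts freely, and an \<open>s\<close>-torus has \<open>2\<^sup>s\<close> elements of order dividing 2.\<close>

lemma zero_in_free_toric_dims: "0 \<in> free_toric_dims m K"
proof -
  let ?e = "\<one>\<^bsub>torus_group m\<^esub>"
  let ?f = "\<lambda>_::nat \<Rightarrow> complex. ?e"
  interpret group "torus_group m" by (rule group_torus_group)
  have e: "?e \<in> topspace (torus_topology m)"
    by (simp add: torus_group_def torus_topology_def circle_group_def PiE_iff)
  have "Hausdorff_space (torus_topology m)"
    by (simp add: torus_topology_def Hausdorff_space_product_topology Hausdorff_space_subtopology)
  then have cl: "closedin (torus_topology m) {?e}"
    using e by (simp add: closedin_Hausdorff_singleton)
  have iso: "?f \<in> iso (torus_group 0) (torus_group m\<lparr>carrier := {?e}\<rparr>)"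
    by (auto simp: iso_def hom_def bij_betw_def) (auto simp: torus_group_def)
  have top0: "topspace (torus_topology 0) = {\<lambda>_. undefined}"
    by (simp add: torus_topology_def)
  have "continuous_map (torus_topology 0) (subtopology (torus_topology m) {?e}) ?f"
    using e by (simp add: continuous_map_in_subtopology)
  moreover have "continuous_map (subtopology (torus_topology m) {?e}) (torus_topology 0)
      (\<lambda>_. \<lambda>_. undefined)"
    using top0 by simp
  ultimately have "homeomorphic_maps (torus_topology 0) (subtopology (torus_topology m) {?e})
      ?f (\<lambda>_. \<lambda>_. undefined)"
    using top0 by (simp add: homeomorphic_maps_def)
  then have "homeomorphic_map (torus_topology 0) (subtopology (torus_topology m) {?e}) ?f"
    by (rule homeomorphic_maps_imp_map)
  with cl iso have "toric_subgroup m 0 {?e}"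
    unfolding toric_subgroup_def using triv_subgroup by blast
  then show ?thesis
    by (auto simp: free_toric_dims_def acts_freely_def)
qed

lemma free_toric_dims_le:
  assumes "s \<in> free_toric_dims m K"
  shows "s \<le> m"
proof -
  define tors where "tors n = (PiE {1..n} (\<lambda>_. {1, -1}) :: (nat \<Rightarrow> complex) set)" for n
  have card: "card (tors n) = 2 ^ n" and fin: "finite (tors n)" for n
    by (simp_all add: tors_def card_PiE finite_PiE numeral_2_eq_2)
  have tors: "tors n = {x \<in> carrier (torus_group n). x \<otimes>\<^bsub>torus_group n\<^esub> x = \<one>\<^bsub>torus_group n\<^esub>}" for n
  proof -
    have A: "z = 1 \<or> z = -1 \<longleftrightarrow> norm z = 1 \<and> z * z = 1" for z :: complex
      by (auto simp: square_eq_1_iff)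
    have B: "(\<lambda>i\<in>{1..n}. x i * x i) = (\<lambda>i\<in>{1..n}. 1) \<longleftrightarrow> (\<forall>i\<in>{1..n}. x i * x i = 1)"
      for x :: "nat \<Rightarrow> complex"
      by (auto simp: fun_eq_iff restrict_def)
    show ?thesis
    proof (rule Set.set_eqI)
      fix x :: "nat \<Rightarrow> complex"
      have "x \<in> tors n \<longleftrightarrow>
          x \<in> extensional {1..n} \<and> (\<forall>i\<in>{1..n}. norm (x i) = 1 \<and> x i * x i = 1)"
        unfolding A [symmetric] tors_def PiE_iff by blast
      also have "\<dots> \<longleftrightarrow> x \<in> {x \<in> carrier (torus_group n).
          x \<otimes>\<^bsub>torus_group n\<^esub> x = \<one>\<^bsub>torus_group n\<^esub>}"
        unfolding torus_group_def circle_group_def carrier_product_group mult_product_group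
          one_product_group monoid.simps mem_Collect_eq B PiE_iff by auto
      finally show "x \<in> tors n \<longleftrightarrow> x \<in> {x \<in> carrier (torus_group n).
          x \<otimes>\<^bsub>torus_group n\<^esub> x = \<one>\<^bsub>torus_group n\<^esub>}" .
    qed
  qed
  from assms obtain H \<phi> where H: "subgroup H (torus_group m)"
    and \<phi>: "\<phi> \<in> iso (torus_group s) (torus_group m\<lparr>carrier := H\<rparr>)"
    by (auto simp: free_toric_dims_def toric_subgroup_def)
  interpret group_hom "torus_group s" "torus_group m" \<phi>
    using \<phi> subgroup.subset[OF H] group_torus_group
    by (auto simp: group_hom_def group_hom_axioms_def iso_def hom_def)
  have sub: "tors s \<subseteq> carrier (torus_group s)"
    unfolding tors by blast
  have "inj_on \<phi> (carrier (torus_group s))"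
    using \<phi> by (simp add: iso_def bij_betw_def)
  then have "inj_on \<phi> (tors s)"
    using sub by (rule inj_on_subset)
  moreover have "\<phi> ` tors s \<subseteq> tors m"
  proof clarify
    fix x assume x: "x \<in> tors s"
    then have xc: "x \<in> carrier (torus_group s)"
      and x2: "x \<otimes>\<^bsub>torus_group s\<^esub> x = \<one>\<^bsub>torus_group s\<^esub>"
      unfolding tors by blast+
    have "\<phi> x \<otimes>\<^bsub>torus_group m\<^esub> \<phi> x = \<one>\<^bsub>torus_group m\<^esub>"
      using hom_mult[OF xc xc] x2 hom_one by metis
    with hom_closed[OF xc] show "\<phi> x \<in> tors m"
      unfolding tors by blast
  qed
  ultimately have "card (tors s) \<le> card (tors m)"
    using fin by (metis card_inj_on_le)
  then show ?thesis by (simp add: card)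
qed

definition buchstaber_invariant :: "nat \<Rightarrow> nat set set \<Rightarrow> nat" where
  "buchstaber_invariant m K = Max (free_toric_dims m K)"

end

theory Submission
  imports Defs
begin

text \<open>
An element \<open>t\<close> of the torus fixes a point of the moment-angle complex if and only if
\<open>{i. t i \<noteq> 1}\<close> is a simplex. So a toric subgroup acts freely exactly when the supports
\<open>{i. t i \<noteq> 1}\<close> of its nontrivial elements are non-simplices (\<open>acts_freely_iff\<close>).

Suppose that an \<open>s\<close>-torus acts freely. Its elements of order two form, together with 1, a vector
space of dimension \<open>s\<close> over the field with two elements. All their coordinates are 1 or -1, and
their supports contain minimal non-simplices. Label every nonzero vector, that is, every point of
the projective space of dimension \<open>s - 1\<close> over this field, by such a minimal non-simplex. If
\<open>a * b = c\<close>, then no coordinate of all three of \<open>a\<close>, \<open>b\<close>, \<open>c\<close> is -1; hence the labels on each line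
have empty intersection (\<open>projective_labelling_of_free_torus\<close>).

Conversely, let \<open>r \<le> 3\<close> and let the points be labelled by minimal non-simplices such that the labels
on each line have empty intersection. For a fixed vertex \<open>i\<close>, the points whose label contains \<open>i\<close>
include no line. In the Fano plane each such set avoids some line (\<open>odd_transversal\<close>); in other
words some linear form \<open>v i\<close> takes the value 1 on all of it. Lift the form to a character of the
\<open>r\<close>-torus with exponents 0 and 1. These characters embed the \<open>r\<close>-torus freely, because every
nontrivial \<open>t\<close> has a point \<open>A\<close> such that every character that is odd on \<open>A\<close> differs from 1 at \<open>t\<close>;
then the label of \<open>A\<close> lies in the support of the image of \<open>t\<close> (\<open>odd_detector\<close>,
\<open>free_torus_of_odd_transversal\<close>). Both steps depend on \<open>r \<le> 3\<close>. The second one is an elementary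
form of the following fact: for \<open>r \<le> 3\<close>, 0-1 vectors of length \<open>r\<close> that form a basis modulo 2 also
form a basis of the integer lattice, since their determinant is odd and at most 2 in absolute value.

So the first three thresholds are governed by labellings of a point, of a line, and of the Fano
plane. The labels may repeat, and the listed forms are what remains after removing repetitions. In
the Fano plane any two points look alike, so the first identification always leads to the same
pattern of six sets; every further coincidence leads to a smaller pattern, and each pattern in turn
is a special case of the next larger one.
\<close>

section \<open>Minimal non-simplices and free actions\<close>

text \<open>
A non-simplex that is not minimal contains a smaller non-simplex, and vertex sets are finite.
\<close>

lemma exists_min_nonsimplex_subset:
  assumes "A \<subseteq> {1..m}" "A \<notin> K"
  shows "\<exists>\<omega>\<in>min_nonsimplices m K. \<omega> \<subseteq> A"
proof -
  have "finite A"
    using assms(1) finite_subset by blast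
  then show ?thesis
    using assms
  proof (induction A rule: finite_psubset_induct)
    case (psubset A)
    show ?case
    proof (cases "A \<in> min_nonsimplices m K")
      case False
      then obtain B where "B \<subset> A" "B \<notin> K"
        using psubset.prems by (auto simp: min_nonsimplices_def)
      then show ?thesis
        using psubset.IH[of B] psubset.prems by blast
    qed blast
  qed
qed

lemma empty_in_complex: "abstract_simplicial_complex m K \<Longrightarrow> {} \<in> K"
  unfolding abstract_simplicial_complex_def by blast

lemma empty_notin_min_nonsimplices:
  "abstract_simplicial_complex m K \<Longrightarrow> {} \<notin> min_nonsimplices m K"
  using empty_in_complex by (simp add: min_nonsimplices_def)

lemma min_nonsimplices_nonempty_iff:
  assumes "abstract_simplicial_complex m K"
  shows "min_nonsimplices m K \<noteq> {} \<longleftrightarrow> K \<noteq> Pow {1..m}"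
proof
  show "K \<noteq> Pow {1..m}" if "min_nonsimplices m K \<noteq> {}"
    using that by (auto simp: min_nonsimplices_def)
  assume "K \<noteq> Pow {1..m}"
  then obtain A where "A \<subseteq> {1..m}" "A \<notin> K"
    using assms by (auto simp: abstract_simplicial_complex_def)
  then show "min_nonsimplices m K \<noteq> {}"
    using exists_min_nonsimplex_subset by blast
qed

lemma le_buchstaber_invariant_iff:
  "r \<le> buchstaber_invariant m K \<longleftrightarrow> (\<exists>s\<in>free_toric_dims m K. r \<le> s)"
proof -
  have "free_toric_dims m K \<subseteq> {..m}"
    by (intro subsetI) (simp add: free_toric_dims_le)
  then have "finite (free_toric_dims m K)"
    using finite_subset by blast
  moreover have "free_toric_dims m K \<noteq> {}"
    using zero_in_free_toric_dims by blast
  ultimately show ?thesis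
    unfolding buchstaber_invariant_def by (rule Max_ge_iff)
qed

lemma carrier_torus_group: "carrier (torus_group n) = PiE {1..n} (\<lambda>_. sphere 0 1)"
  by (simp add: torus_group_def circle_group_def)

lemma mult_torus_group: "x \<otimes>\<^bsub>torus_group n\<^esub> y = (\<lambda>i\<in>{1..n}. x i * y i)"
  by (simp add: torus_group_def circle_group_def)

lemma one_torus_group: "\<one>\<^bsub>torus_group n\<^esub> = (\<lambda>i\<in>{1..n}. 1)"
  by (simp add: torus_group_def circle_group_def)

lemma topspace_torus_topology: "topspace (torus_topology n) = carrier (torus_group n)"
  by (simp add: torus_topology_def carrier_torus_group)

lemma torus_element_eq_one_iff:
  assumes "t \<in> carrier (torus_group r)"
  shows "t = \<one>\<^bsub>torus_group r\<^esub> \<longleftrightarrow> (\<forall>j\<in>{1..r}. t j = 1)"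
  using assms by (auto simp: carrier_torus_group one_torus_group PiE_iff extensional_def fun_eq_iff)

text \<open>
An element fixes \<open>x\<close> if and only if \<open>x\<close> vanishes wherever the element differs from 1. So the
element has a fixed point in the complex if and only if its support is a simplex.
\<close>

lemma acts_freely_iff:
  assumes "abstract_simplicial_complex m K" "H \<subseteq> carrier (torus_group m)"
  shows "acts_freely m H (moment_angle_complex m K) \<longleftrightarrow>
    (\<forall>t\<in>H. {i \<in> {1..m}. t i \<noteq> 1} \<in> K \<longrightarrow> t = \<one>\<^bsub>torus_group m\<^esub>)"
proof
  assume free: "acts_freely m H (moment_angle_complex m K)"
  show "\<forall>t\<in>H. {i \<in> {1..m}. t i \<noteq> 1} \<in> K \<longrightarrow> t = \<one>\<^bsub>torus_group m\<^esub>"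
  proof (intro ballI impI)
    fix t assume t: "t \<in> H" and K: "{i \<in> {1..m}. t i \<noteq> 1} \<in> K"
    \<comment> \<open>This point lies in the moment-angle complex and has the smallest
      zero set that a point fixed by \<open>t\<close> can have.\<close>
    define x :: "nat \<Rightarrow> complex" where "x = (\<lambda>i\<in>{1..m}. if t i = 1 then 1 else 0)"
    have "{i \<in> {1..m}. x i \<notin> sphere 0 1} = {i \<in> {1..m}. t i \<noteq> 1}"
      by (auto simp: x_def)
    with K have "x \<in> moment_angle_complex m K"
      by (auto simp: moment_angle_complex_def x_def)
    moreover have "torus_action m t x = x"
      by (auto simp: torus_action_def x_def fun_eq_iff)
    ultimately show "t = \<one>\<^bsub>torus_group m\<^esub>"
      using free t by (auto simp: acts_freely_def)
  qed
next
  assume *: "\<forall>t\<in>H. {i \<in> {1..m}. t i \<noteq> 1} \<in> K \<longrightarrow> t = \<one>\<^bsub>torus_group m\<^esub>"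
  show "acts_freely m H (moment_angle_complex m K)"
    unfolding acts_freely_def
  proof (intro ballI impI)
    fix t x assume t: "t \<in> H" and x: "x \<in> moment_angle_complex m K" and fixed: "torus_action m t x = x"
    have "x i = 0" if "i \<in> {1..m}" "t i \<noteq> 1" for i
      using fun_cong[OF fixed, of i] that by (simp add: torus_action_def)
    then have "{i \<in> {1..m}. t i \<noteq> 1} \<subseteq> {i \<in> {1..m}. x i \<notin> sphere 0 1}"
      by auto
    with x assms(1) have "{i \<in> {1..m}. t i \<noteq> 1} \<in> K"
      unfolding moment_angle_complex_def abstract_simplicial_complex_def by blast
    with * t show "t = \<one>\<^bsub>torus_group m\<^esub>" by blast
  qed
qed

section \<open>From free tori to labelled projective spaces\<close>

text \<open>
The nonempty subsets of \<open>{1..r}\<close>, read as 0-1 vectors, are the points of the projective space of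
dimension \<open>r - 1\<close> over the field with two elements, and \<open>A\<close>, \<open>B\<close>, \<open>sym_diff A B\<close> are the points of
a line. For \<open>r = 3\<close> this is the Fano plane.
\<close>

definition projective_labelling :: "nat \<Rightarrow> 'a set set \<Rightarrow> (nat set \<Rightarrow> 'a set) \<Rightarrow> bool" where
  "projective_labelling r N \<tau> \<longleftrightarrow>
     (\<forall>A\<in>Pow {1..r} - {{}}. \<tau> A \<in> N) \<and>
     (\<forall>A\<in>Pow {1..r} - {{}}. \<forall>B\<in>Pow {1..r} - {{}}. A \<noteq> B \<longrightarrow> \<tau> A \<inter> \<tau> B \<inter> \<tau> (sym_diff A B) = {})"

lemma projective_labelling_line:
  assumes "projective_labelling r N \<tau>" "A \<in> Pow {1..r} - {{}}" "B \<in> Pow {1..r} - {{}}" "A \<noteq> B"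
  shows "\<tau> A \<inter> \<tau> B \<inter> \<tau> (sym_diff A B) = {}"
  using assms unfolding projective_labelling_def by blast

text \<open>
The images of the elements of order two have coordinates 1 and -1. The product of three such
elements that form a line is 1, so -1 occurs an even number of times in each coordinate and their
supports have no common vertex. The labels are minimal non-simplices inside these supports.
\<close>

lemma projective_labelling_of_free_torus:
  assumes K: "abstract_simplicial_complex m K" and s: "s \<in> free_toric_dims m K"
  shows "\<exists>\<tau>. projective_labelling s (min_nonsimplices m K) \<tau>"
proof -
  obtain H \<phi> where H: "subgroup H (torus_group m)"
    and free: "acts_freely m H (moment_angle_complex m K)"
    and \<phi>: "\<phi> \<in> iso (torus_group s) (torus_group m\<lparr>carrier := H\<rparr>)"
    using s by (auto simp: free_toric_dims_def toric_subgroup_def)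
  interpret group_hom "torus_group s" "torus_group m" \<phi>
    using \<phi> subgroup.subset[OF H] group_torus_group
    by (auto simp: group_hom_def group_hom_axioms_def iso_def hom_def)
  have inj: "inj_on \<phi> (carrier (torus_group s))" and img: "\<phi> ` carrier (torus_group s) = H"
    using \<phi> by (simp_all add: iso_def bij_betw_def)
  \<comment> \<open>The 2-torsion of the \<open>s\<close>-torus, indexed so that multiplication becomes symmetric difference.\<close>
  define e :: "nat set \<Rightarrow> nat \<Rightarrow> complex" where "e A = (\<lambda>j\<in>{1..s}. if j \<in> A then -1 else 1)" for A
  have e_carrier: "e A \<in> carrier (torus_group s)" for A
    by (auto simp: e_def carrier_torus_group)
  have e_mult: "e A \<otimes>\<^bsub>torus_group s\<^esub> e B = e (sym_diff A B)" for A B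
    by (auto simp: e_def mult_torus_group)
  have e_empty: "e {} = \<one>\<^bsub>torus_group s\<^esub>"
    by (auto simp: e_def one_torus_group)
  have coord: "\<phi> (e (sym_diff A B)) i = \<phi> (e A) i * \<phi> (e B) i" if "i \<in> {1..m}" for A B i
    using fun_cong[OF hom_mult[OF e_carrier e_carrier, unfolded e_mult], of A B i] that
    by (simp add: mult_torus_group)
  have sign: "\<phi> (e A) i \<in> {1, -1}" if "i \<in> {1..m}" for A i
    using coord[OF that, of A A] that hom_one by (simp add: e_empty one_torus_group square_eq_1_iff)
  define S where "S A = {i \<in> {1..m}. \<phi> (e A) i \<noteq> 1}" for A
  have "\<exists>\<omega>\<in>min_nonsimplices m K. \<omega> \<subseteq> S A" if A: "A \<in> Pow {1..s} - {{}}" for A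
  proof (rule exists_min_nonsimplex_subset)
    show "S A \<notin> K"
    proof
      assume "S A \<in> K"
      \<comment> \<open>Freeness makes \<open>\<phi> (e A)\<close> trivial, against the injectivity of \<open>\<phi>\<close>.\<close>
      then have "\<phi> (e A) = \<phi> (e {})"
        using free acts_freely_iff[OF K subgroup.subset[OF H]] img e_carrier hom_one
        by (auto simp: S_def e_empty)
      then have "e A = e {}"
        using inj e_carrier by (auto dest: inj_onD)
      moreover obtain j where "j \<in> A" "j \<in> {1..s}"
        using A by blast
      ultimately show False
        by (auto dest: fun_cong[of _ _ j] simp: e_def)
    qed
  qed (auto simp: S_def)
  then obtain \<tau> where \<tau>: "\<And>A. A \<in> Pow {1..s} - {{}} \<Longrightarrow> \<tau> A \<in> min_nonsimplices m K"
      "\<And>A. A \<in> Pow {1..s} - {{}} \<Longrightarrow> \<tau> A \<subseteq> S A"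
    by metis
  have disj: "S A \<inter> S B \<inter> S (sym_diff A B) = {}" for A B
  proof -
    have False if "i \<in> S A" "i \<in> S B" "i \<in> S (sym_diff A B)" for i
      using that coord[of i A B] sign[of i A] sign[of i B] by (auto simp: S_def)
    then show ?thesis by blast
  qed
  have "projective_labelling s (min_nonsimplices m K) \<tau>"
    unfolding projective_labelling_def
  proof (intro conjI ballI impI)
    fix A B assume AB: "A \<in> Pow {1..s} - {{}}" "B \<in> Pow {1..s} - {{}}" "A \<noteq> B"
    then have "sym_diff A B \<in> Pow {1..s} - {{}}"
      by auto
    with AB have "\<tau> A \<inter> \<tau> B \<inter> \<tau> (sym_diff A B) \<subseteq> S A \<inter> S B \<inter> S (sym_diff A B)"
      by (intro Int_mono \<tau>)
    with disj show "\<tau> A \<inter> \<tau> B \<inter> \<tau> (sym_diff A B) = {}"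
      by simp
  qed (rule \<tau>)
  then show ?thesis by blast
qed

lemma projective_labelling_mono:
  assumes "projective_labelling s N \<tau>" "r \<le> s"
  shows "projective_labelling r N \<tau>"
proof -
  have pts: "A \<in> Pow {1..s} - {{}}" if "A \<in> Pow {1..r} - {{}}" for A
    using that assms(2) by auto
  show ?thesis
    unfolding projective_labelling_def
  proof (intro conjI ballI impI)
    show "\<tau> A \<in> N" if "A \<in> Pow {1..r} - {{}}" for A
      using assms(1) pts[OF that] by (simp add: projective_labelling_def)
    show "\<tau> A \<inter> \<tau> B \<inter> \<tau> (sym_diff A B) = {}"
      if "A \<in> Pow {1..r} - {{}}" "B \<in> Pow {1..r} - {{}}" "A \<noteq> B" for A B
      using projective_labelling_line[OF assms(1) pts pts, OF that] .
  qed
qed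

lemma labelling_of_le_buchstaber_invariant:
  assumes "abstract_simplicial_complex m K" "r \<le> buchstaber_invariant m K"
  shows "\<exists>\<tau>. projective_labelling r (min_nonsimplices m K) \<tau>"
proof -
  obtain s where "s \<in> free_toric_dims m K" "r \<le> s"
    using assms(2) le_buchstaber_invariant_iff by blast
  then show ?thesis
    using projective_labelling_of_free_torus[OF assms(1)] projective_labelling_mono by blast
qed

section \<open>Free tori from characters with exponents 0 and 1\<close>

text \<open>
The characters \<open>t \<mapsto> \<Prod>j\<in>v i. t j\<close> are the coordinates of a homomorphism of tori. The last hypothesis
makes it injective with an image that acts freely, and compactness makes it an embedding with
closed image.
\<close>

lemma free_torus_of_squarefree_characters:
  assumes K: "abstract_simplicial_complex m K"
    and v: "\<And>i. v i \<subseteq> {1..r}"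
    and free: "\<And>t. \<lbrakk>t \<in> carrier (torus_group r); t \<noteq> \<one>\<^bsub>torus_group r\<^esub>\<rbrakk> \<Longrightarrow>
                 {i \<in> {1..m}. (\<Prod>j\<in>v i. t j) \<noteq> 1} \<notin> K"
  shows "r \<in> free_toric_dims m K"
proof -
  define \<phi> :: "(nat \<Rightarrow> complex) \<Rightarrow> nat \<Rightarrow> complex" where "\<phi> t = (\<lambda>i\<in>{1..m}. \<Prod>j\<in>v i. t j)" for t
  define H where "H = \<phi> ` carrier (torus_group r)"
  have norm: "norm (t j) = 1" if "t \<in> carrier (torus_group r)" "j \<in> v i" for t i j
    using that v by (fastforce simp: carrier_torus_group)
  interpret group_hom "torus_group r" "torus_group m" \<phi>
  proof (unfold group_hom_def group_hom_axioms_def, intro conjI group_torus_group homI)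
    fix t assume "t \<in> carrier (torus_group r)"
    then show "\<phi> t \<in> carrier (torus_group m)"
      using norm by (auto simp: \<phi>_def carrier_torus_group[of m] prod_norm[symmetric])
  next
    fix t u
    have "(\<Prod>j\<in>v i. (t \<otimes>\<^bsub>torus_group r\<^esub> u) j) = (\<Prod>j\<in>v i. t j) * (\<Prod>j\<in>v i. u j)" for i
      unfolding prod.distrib[symmetric] mult_torus_group
      by (intro prod.cong) (use subsetD[OF v] in auto)
    then show "\<phi> (t \<otimes>\<^bsub>torus_group r\<^esub> u) = \<phi> t \<otimes>\<^bsub>torus_group m\<^esub> \<phi> u"
      by (auto simp: \<phi>_def mult_torus_group[of m])
  qed
  have nontriv: "{i \<in> {1..m}. \<phi> t i \<noteq> 1} \<notin> K"
    if "t \<in> carrier (torus_group r)" "t \<noteq> \<one>\<^bsub>torus_group r\<^esub>" for t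
  proof -
    have "{i \<in> {1..m}. \<phi> t i \<noteq> 1} = {i \<in> {1..m}. (\<Prod>j\<in>v i. t j) \<noteq> 1}"
      by (auto simp: \<phi>_def)
    with free[OF that] show ?thesis by simp
  qed
  have inj: "inj_on \<phi> (carrier (torus_group r))"
    unfolding inj_on_one_iff
  proof (intro allI impI, rule ccontr)
    fix t assume t: "t \<in> carrier (torus_group r)" "\<phi> t = \<one>\<^bsub>torus_group m\<^esub>" "t \<noteq> \<one>\<^bsub>torus_group r\<^esub>"
    then have "{i \<in> {1..m}. \<phi> t i \<noteq> 1} = {}"
      by (auto simp: one_torus_group)
    \<comment> \<open>The empty set is a simplex, so the free action already forces injectivity.\<close>
    with nontriv[OF t(1,3)] empty_in_complex[OF K] show False by metis
  qed
  have sub: "subgroup H (torus_group m)"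
    unfolding H_def by (rule img_is_subgroup)
  have iso: "\<phi> \<in> iso (torus_group r) (torus_group m\<lparr>carrier := H\<rparr>)"
    using inj by (auto simp: iso_def hom_def bij_betw_def H_def)
  have cont: "continuous_map (torus_topology r) (torus_topology m) \<phi>"
  proof -
    have proj: "continuous_map (torus_topology r) euclidean (\<lambda>t. t j)" if "j \<in> {1..r}" for j
      using continuous_map_product_projection[OF that, of "\<lambda>_. top_of_set (sphere (0::complex) 1)"]
      by (simp add: torus_topology_def continuous_map_in_subtopology)
    have "continuous_map (torus_topology r) euclidean (\<lambda>t. \<Prod>j\<in>v i. t j)" for i
      using v[of i] proj unfolding continuous_map_atin limitin_canonical_iff
      by (intro ballI tendsto_prod) blast
    then show ?thesis
      using hom_closed
      by (auto simp: torus_topology_def[of m] continuous_map_componentwise continuous_map_in_subtopology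
           topspace_torus_topology carrier_torus_group[of m] \<phi>_def)
  qed
  have cpt: "compact_space (torus_topology r)"
    by (simp add: torus_topology_def compact_space_product_topology compact_space_subtopology)
  have haus: "Hausdorff_space (torus_topology m)"
    by (simp add: torus_topology_def Hausdorff_space_product_topology Hausdorff_space_subtopology)
  have "compactin (torus_topology m) H"
    unfolding H_def topspace_torus_topology[symmetric]
    using cpt cont by (intro image_compactin) (auto simp: compact_space_def)
  then have closed: "closedin (torus_topology m) H"
    using haus by (rule compactin_imp_closedin[rotated])
  have "homeomorphic_map (torus_topology r) (subtopology (torus_topology m) H) \<phi>"
  proof (rule continuous_imp_homeomorphic_map)
    show "\<phi> ` topspace (torus_topology r) = topspace (subtopology (torus_topology m) H)"
      using subgroup.subset[OF sub] by (auto simp: topspace_torus_topology H_def)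
    show "continuous_map (torus_topology r) (subtopology (torus_topology m) H) \<phi>"
      using cont by (auto simp: continuous_map_in_subtopology topspace_torus_topology H_def)
  qed (use cpt haus inj in \<open>auto simp: topspace_torus_topology Hausdorff_space_subtopology\<close>)
  with sub closed iso have "toric_subgroup m r H"
    unfolding toric_subgroup_def by blast
  moreover have "acts_freely m H (moment_angle_complex m K)"
    unfolding acts_freely_iff[OF K subgroup.subset[OF sub]]
  proof (intro ballI impI)
    fix h assume "h \<in> H" and h: "{i \<in> {1..m}. h i \<noteq> 1} \<in> K"
    then obtain t where t: "t \<in> carrier (torus_group r)" "h = \<phi> t"
      by (auto simp: H_def)
    with nontriv[OF t(1)] h have "t = \<one>\<^bsub>torus_group r\<^esub>"
      by blast
    with t(2) show "h = \<one>\<^bsub>torus_group m\<^esub>"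
      using hom_one by (simp only:)
  qed
  ultimately show ?thesis
    unfolding free_toric_dims_def by blast
qed

text \<open>
Only the coordinates different from 1 matter; let \<open>J\<close> be the set of their indices. If \<open>v\<close> meets \<open>J\<close>
in one element, the product over \<open>v\<close> is a coordinate and hence not 1. As \<open>J\<close> has at most three
elements, the only other odd intersection is \<open>J\<close> itself.
\<close>

lemma odd_detector:
  fixes t :: "nat \<Rightarrow> complex"
  assumes "j0 \<in> {1..r}" "t j0 \<noteq> 1" and r: "r \<le> 3"
  obtains A where "A \<subseteq> {1..r}" "A \<noteq> {}"
    "\<And>v. v \<subseteq> {1..r} \<Longrightarrow> odd (card (A \<inter> v)) \<Longrightarrow> (\<Prod>j\<in>v. t j) \<noteq> 1"
proof -
  define J where "J = {j \<in> {1..r}. t j \<noteq> 1}"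
  have J: "J \<subseteq> {1..r}" "J \<noteq> {}"
    using assms by (auto simp: J_def)
  have "finite J" using J finite_subset by blast
  have "card J \<le> card {1..r}"
    using J(1) by (intro card_mono) auto
  then have "card J \<le> 3" using r by simp
  have prod_J: "(\<Prod>j\<in>v. t j) = (\<Prod>j\<in>J \<inter> v. t j)" if "v \<subseteq> {1..r}" for v
    using that by (intro prod.mono_neutral_right) (auto simp: J_def intro: finite_subset)
  have single: "(\<Prod>j\<in>v. t j) \<noteq> 1" if v: "v \<subseteq> {1..r}" "card (J \<inter> v) = 1" for v
  proof -
    obtain j where j: "J \<inter> v = {j}" using v(2) by (auto simp: card_1_singleton_iff)
    then have "t j \<noteq> 1" by (auto simp: J_def)
    with j prod_J[OF v(1)] show ?thesis by simp
  qed
  show thesis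
  \<comment> \<open>If \<open>J\<close> itself is no witness, then \<open>J\<close> has three elements and the product of all
    three coordinates is 1, so that the product of any two of them is not.\<close>
  proof (cases "card J \<le> 2 \<or> (\<Prod>j\<in>J. t j) \<noteq> 1")
    case True
    show thesis
    proof (rule that[OF J])
      fix v assume v: "v \<subseteq> {1..r}" "odd (card (J \<inter> v))"
      have "card (J \<inter> v) \<le> card J"
        using \<open>finite J\<close> by (intro card_mono) auto
      with v(2) \<open>card J \<le> 3\<close> have "card (J \<inter> v) = 1 \<or> card (J \<inter> v) = 3 \<and> card J = 3"
        by presburger
      then consider "card (J \<inter> v) = 1" | "card (J \<inter> v) = 3" "card J = 3"
        by blast
      then show "(\<Prod>j\<in>v. t j) \<noteq> 1"
      proof cases
        case 1
        then show ?thesis by (rule single[OF v(1)])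
      next
        case 2
        then have "J \<inter> v = J"
          using \<open>finite J\<close> by (intro card_subset_eq) auto
        with 2 True prod_J[OF v(1)] show ?thesis by simp
      qed
    qed
  next
    case False
    with \<open>card J \<le> 3\<close> have "card J = 3" "(\<Prod>j\<in>J. t j) = 1" by auto
    then obtain a b c where abc: "J = {a, b, c}" "a \<noteq> b" "a \<noteq> c" "b \<noteq> c"
      by (auto simp: card_3_iff)
    show thesis
    proof (rule that[of "{a, b}"])
      show "{a, b} \<subseteq> {1..r}" using J abc by auto
      fix v assume v: "v \<subseteq> {1..r}" "odd (card ({a, b} \<inter> v))"
      have ne: "t a \<noteq> 1" "t b \<noteq> 1" "t c \<noteq> 1" and prod: "t a * t b * t c = 1"
        using abc \<open>(\<Prod>j\<in>J. t j) = 1\<close> by (auto simp: J_def mult.assoc)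
      have "t a * t c \<noteq> 1"
      proof
        assume "t a * t c = 1"
        with prod have "t b = 1" by (metis mult.assoc mult.commute mult.right_neutral)
        with ne show False by simp
      qed
      moreover have "t b * t c \<noteq> 1"
      proof
        assume "t b * t c = 1"
        with prod have "t a = 1" by (simp add: mult.assoc)
        with ne show False by simp
      qed
      moreover have "a \<in> v \<longleftrightarrow> b \<notin> v"
        using v(2) abc(2) by (cases "a \<in> v"; cases "b \<in> v") simp_all
      ultimately show "(\<Prod>j\<in>v. t j) \<noteq> 1"
        unfolding prod_J[OF v(1)] abc(1) using ne abc(2-4)
        by (cases "a \<in> v"; cases "c \<in> v") simp_all
    qed auto
  qed
qed

text \<open>
A nontrivial element of the torus has a point \<open>A\<close> detected by all sets that meet \<open>A\<close> oddly. By
hypothesis these include \<open>v i\<close> for all \<open>i \<in> \<tau> A\<close>, so the support of the image contains the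
non-simplex \<open>\<tau> A\<close>.
\<close>

lemma free_torus_of_odd_transversal:
  assumes K: "abstract_simplicial_complex m K" and r: "r \<le> 3"
    and \<tau>: "\<And>A. A \<in> Pow {1..r} - {{}} \<Longrightarrow> \<tau> A \<in> min_nonsimplices m K"
    and v: "\<And>i. v i \<subseteq> {1..r}"
    and odd: "\<And>A i. A \<in> Pow {1..r} - {{}} \<Longrightarrow> i \<in> \<tau> A \<Longrightarrow> odd (card (A \<inter> v i))"
  shows "r \<in> free_toric_dims m K"
proof (rule free_torus_of_squarefree_characters[OF K v])
  fix t assume t: "t \<in> carrier (torus_group r)" "t \<noteq> \<one>\<^bsub>torus_group r\<^esub>"
  then obtain j where "j \<in> {1..r}" "t j \<noteq> 1"
    using torus_element_eq_one_iff by blast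
  then obtain A where A: "A \<in> Pow {1..r} - {{}}"
    and *: "\<And>v. v \<subseteq> {1..r} \<Longrightarrow> odd (card (A \<inter> v)) \<Longrightarrow> (\<Prod>j\<in>v. t j) \<noteq> 1"
    using odd_detector[OF _ _ r, of j t] by (metis Diff_iff PowI singletonD)
  have "\<tau> A \<subseteq> {i \<in> {1..m}. (\<Prod>j\<in>v i. t j) \<noteq> 1}"
  proof
    fix i assume "i \<in> \<tau> A"
    with *[OF v odd[OF A]] \<tau>[OF A] show "i \<in> {i \<in> {1..m}. (\<Prod>j\<in>v i. t j) \<noteq> 1}"
      unfolding min_nonsimplices_def by blast
  qed
  moreover have "\<tau> A \<notin> K"
    using \<tau>[OF A] by (simp add: min_nonsimplices_def)
  ultimately show "{i \<in> {1..m}. (\<Prod>j\<in>v i. t j) \<noteq> 1} \<notin> K"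
    using K unfolding abstract_simplicial_complex_def by blast
qed

section \<open>Seven sets and the patterns to which they degenerate\<close>

text \<open>
The seven triples are the lines of the Fano plane, with the points \<open>{1}\<close>, \<open>{2}\<close>, \<open>{3}\<close>, \<open>{1,2}\<close>,
\<open>{1,3}\<close>, \<open>{2,3}\<close>, \<open>{1,2,3}\<close> numbered in this order.
\<close>

definition seven_pattern :: "'a set \<Rightarrow> 'a set \<Rightarrow> 'a set \<Rightarrow> 'a set \<Rightarrow> 'a set \<Rightarrow> 'a set \<Rightarrow> 'a set \<Rightarrow> bool" where
  "seven_pattern t1 t2 t3 t4 t5 t6 t7 \<longleftrightarrow>
     t1 \<inter> t2 \<inter> t4 = {} \<and> t1 \<inter> t3 \<inter> t5 = {} \<and> t1 \<inter> t6 \<inter> t7 = {} \<and>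
     t2 \<inter> t3 \<inter> t6 = {} \<and> t2 \<inter> t5 \<inter> t7 = {} \<and> t3 \<inter> t4 \<inter> t7 = {} \<and>
     t4 \<inter> t5 \<inter> t6 = {}"

text \<open>
The Fano pattern with two equal labels \<open>t1\<close>; the third label on their line is \<open>t3\<close>. The remaining
four points form the 4-cycle \<open>t2\<close>, \<open>t4\<close>, \<open>t6\<close>, \<open>t5\<close>: any two neighbours are on a line with one of the
two points labelled \<open>t1\<close>, and any two opposite ones are on a line with the point labelled \<open>t3\<close>.
\<close>

definition six_pattern :: "'a set \<Rightarrow> 'a set \<Rightarrow> 'a set \<Rightarrow> 'a set \<Rightarrow> 'a set \<Rightarrow> 'a set \<Rightarrow> bool" where
  "six_pattern t1 t2 t3 t4 t5 t6 \<longleftrightarrow>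
     t1 \<inter> t3 = {} \<and> t1 \<inter> t2 \<inter> t4 = {} \<and> t1 \<inter> t2 \<inter> t5 = {} \<and>
     t1 \<inter> t4 \<inter> t6 = {} \<and> t1 \<inter> t5 \<inter> t6 = {} \<and> t2 \<inter> t3 \<inter> t6 = {} \<and>
     t3 \<inter> t4 \<inter> t5 = {}"

definition five_pattern :: "'a set \<Rightarrow> 'a set \<Rightarrow> 'a set \<Rightarrow> 'a set \<Rightarrow> 'a set \<Rightarrow> bool" where
  "five_pattern t1 t2 t3 t4 t5 \<longleftrightarrow>
     t1 \<inter> t2 = {} \<and> t1 \<inter> t5 = {} \<and> t1 \<inter> t3 \<inter> t4 = {} \<and>
     t2 \<inter> t3 \<inter> t5 = {} \<and> t2 \<inter> t4 \<inter> t5 = {}"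

definition four_pattern :: "'a set \<Rightarrow> 'a set \<Rightarrow> 'a set \<Rightarrow> 'a set \<Rightarrow> bool" where
  "four_pattern t1 t2 t3 t4 \<longleftrightarrow> t1 \<inter> (t2 \<union> t3 \<union> t4) = {} \<and> t2 \<inter> t3 \<inter> t4 = {}"

definition three_pattern :: "'a set \<Rightarrow> 'a set \<Rightarrow> 'a set \<Rightarrow> bool" where
  "three_pattern t1 t2 t3 \<longleftrightarrow> t1 \<inter> t2 = {} \<and> t1 \<inter> t3 = {} \<and> t2 \<inter> t3 = {}"

definition has_seven_pattern :: "'a set set \<Rightarrow> bool" where
  "has_seven_pattern N \<longleftrightarrow> (\<exists>t1 t2 t3 t4 t5 t6 t7. distinct [t1, t2, t3, t4, t5, t6, t7] \<and>
     {t1, t2, t3, t4, t5, t6, t7} \<subseteq> N \<and> seven_pattern t1 t2 t3 t4 t5 t6 t7)"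

definition has_six_pattern :: "'a set set \<Rightarrow> bool" where
  "has_six_pattern N \<longleftrightarrow> (\<exists>t1 t2 t3 t4 t5 t6. distinct [t1, t2, t3, t4, t5, t6] \<and>
     {t1, t2, t3, t4, t5, t6} \<subseteq> N \<and> six_pattern t1 t2 t3 t4 t5 t6)"

definition has_five_pattern :: "'a set set \<Rightarrow> bool" where
  "has_five_pattern N \<longleftrightarrow> (\<exists>t1 t2 t3 t4 t5. distinct [t1, t2, t3, t4, t5] \<and>
     {t1, t2, t3, t4, t5} \<subseteq> N \<and> five_pattern t1 t2 t3 t4 t5)"

definition has_four_pattern :: "'a set set \<Rightarrow> bool" where
  "has_four_pattern N \<longleftrightarrow> (\<exists>t1 t2 t3 t4. distinct [t1, t2, t3, t4] \<and>
     {t1, t2, t3, t4} \<subseteq> N \<and> four_pattern t1 t2 t3 t4)"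

definition has_three_pattern :: "'a set set \<Rightarrow> bool" where
  "has_three_pattern N \<longleftrightarrow> (\<exists>t1 t2 t3. distinct [t1, t2, t3] \<and> {t1, t2, t3} \<subseteq> N \<and> three_pattern t1 t2 t3)"

lemma patterns_of_three_pattern:
  assumes "{} \<notin> N" "{x, y, z} \<subseteq> N" "three_pattern x y z"
  shows "has_three_pattern N"
proof -
  have "distinct [x, y, z]"
    using assms by (auto simp: three_pattern_def)
  with assms show ?thesis
    unfolding has_three_pattern_def by blast
qed

text \<open>
Nonempty sets with empty intersection differ, so only the last three sets can coincide. This makes
two of them disjoint.
\<close>

lemma patterns_of_four_pattern:
  assumes "{} \<notin> N" "{x, y, z, w} \<subseteq> N" "four_pattern x y z w"
  shows "has_four_pattern N \<or> has_three_pattern N"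
proof (cases "distinct [x, y, z, w]")
  case True
  with assms show ?thesis
    unfolding has_four_pattern_def by blast
next
  case False
  with assms(1-3) have "three_pattern x y z \<or> three_pattern x y w"
    by (auto simp: four_pattern_def three_pattern_def)
  with assms show ?thesis
    using patterns_of_three_pattern[of N x y z] patterns_of_three_pattern[of N x y w] by blast
qed

text \<open>
The sets \<open>x\<close>, \<open>y\<close> are disjoint and so are \<open>x\<close>, \<open>e\<close>. Any other coincidence turns some of the
conditions on three sets into disjointness of two, which gives one of the smaller patterns.
\<close>

lemma patterns_of_five_pattern:
  assumes "{} \<notin> N" "{x, y, p, q, e} \<subseteq> N" "five_pattern x y p q e"
  shows "has_five_pattern N \<or> has_four_pattern N \<or> has_three_pattern N"
proof (cases "distinct [x, y, p, q, e]")
  case True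
  with assms show ?thesis
    unfolding has_five_pattern_def by blast
next
  case False
  have "x \<noteq> y" "x \<noteq> e"
    using assms by (auto simp: five_pattern_def)
  with False consider "y = e" | "x = p" | "x = q" | "p = q" | "y = p \<or> y = q \<or> p = e \<or> q = e"
    unfolding distinct.simps list.set insert_iff empty_iff by argo
  then show ?thesis
  proof cases
    case 1
    then have "four_pattern y x p q"
      using assms(3) by (auto simp: five_pattern_def four_pattern_def)
    then show ?thesis
      using assms patterns_of_four_pattern[of N y x p q] by auto
  next
    case 2
    then have "four_pattern x y e q"
      using assms(3) by (auto simp: five_pattern_def four_pattern_def)
    then show ?thesis
      using assms patterns_of_four_pattern[of N x y e q] by auto
  next
    case 3
    then have "four_pattern x y e p"
      using assms(3) by (auto simp: five_pattern_def four_pattern_def)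
    then show ?thesis
      using assms patterns_of_four_pattern[of N x y e p] by auto
  next
    case 4
    then have "four_pattern x y e p"
      using assms(3) by (auto simp: five_pattern_def four_pattern_def)
    then show ?thesis
      using assms patterns_of_four_pattern[of N x y e p] by auto
  next
    case 5
    then have "three_pattern x y e"
      using assms(3) by (auto simp: five_pattern_def three_pattern_def)
    then show ?thesis
      using assms patterns_of_three_pattern[of N x y e] by auto
  qed
qed

lemma patterns_of_six_pattern:
  assumes "{} \<notin> N" "{x, p, c, q, r, s} \<subseteq> N" "six_pattern x p c q r s"
  shows "has_six_pattern N \<or> has_five_pattern N \<or> has_four_pattern N \<or> has_three_pattern N"
proof (cases "distinct [x, p, c, q, r, s]")
  case True
  with assms show ?thesis
    unfolding has_six_pattern_def by blast
next
  case False
  have "x \<noteq> c"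
    using assms by (auto simp: six_pattern_def)
  have four: ?thesis if "four_pattern a b d e" "{a, b, d, e} \<subseteq> N" for a b d e
    using patterns_of_four_pattern[OF assms(1) that(2,1)] by blast
  have five: ?thesis if "five_pattern a b d e f" "{a, b, d, e, f} \<subseteq> N" for a b d e f
    using patterns_of_five_pattern[OF assms(1) that(2,1)] by blast
  \<comment> \<open>Among \<open>p\<close>, \<open>q\<close>, \<open>s\<close>, \<open>r\<close>, read as a 4-cycle, \<open>x\<close> controls the sides and \<open>c\<close> the diagonals.
    If \<open>x\<close> is a vertex of the cycle, a pattern of four sets remains, otherwise one of five;
    \<open>c = s\<close> and \<open>p = s\<close> leave the same one, as do \<open>c = r\<close> and \<open>q = r\<close>.\<close>
  from False \<open>x \<noteq> c\<close> consider "x = p \<or> x = s" | "x = q \<or> x = r"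
    | "p = c" | "c = s \<or> p = s" | "c = q" | "c = r \<or> q = r"
    | "p = q" | "p = r" | "q = s" | "r = s"
    unfolding distinct.simps list.set insert_iff empty_iff by argo
  then show ?thesis
  proof cases
    case 1
    then have "four_pattern x c q r"
      using assms(3) by (auto simp: six_pattern_def four_pattern_def)
    then show ?thesis
      using four[of x c q r] assms(2) by blast
  next
    case 2
    then have "four_pattern x c p s"
      using assms(3) by (auto simp: six_pattern_def four_pattern_def)
    then show ?thesis
      using four[of x c p s] assms(2) by blast
  next
    case 3
    then have "five_pattern c x q r s"
      using assms(3) by (auto simp: six_pattern_def five_pattern_def)
    then show ?thesis
      using five[of c x q r s] assms(2) by blast
  next
    case 4
    then have "five_pattern c x q r p"
      using assms(3) by (auto simp: six_pattern_def five_pattern_def)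
    then show ?thesis
      using five[of c x q r p] assms(2) by blast
  next
    case 5
    then have "five_pattern c x p s r"
      using assms(3) by (auto simp: six_pattern_def five_pattern_def)
    then show ?thesis
      using five[of c x p s r] assms(2) by blast
  next
    case 6
    then have "five_pattern c x p s q"
      using assms(3) by (auto simp: six_pattern_def five_pattern_def)
    then show ?thesis
      using five[of c x p s q] assms(2) by blast
  next
    case 7
    then have "five_pattern x c r s p"
      using assms(3) by (auto simp: six_pattern_def five_pattern_def)
    then show ?thesis
      using five[of x c r s p] assms(2) by blast
  next
    case 8
    then have "five_pattern x c q s p"
      using assms(3) by (auto simp: six_pattern_def five_pattern_def)
    then show ?thesis
      using five[of x c q s p] assms(2) by blast
  next
    case 9
    then have "five_pattern x c p r q"
      using assms(3) by (auto simp: six_pattern_def five_pattern_def)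
    then show ?thesis
      using five[of x c p r q] assms(2) by blast
  next
    case 10
    then have "five_pattern x c p q r"
      using assms(3) by (auto simp: six_pattern_def five_pattern_def)
    then show ?thesis
      using five[of x c p q r] assms(2) by blast
  qed
qed

lemma seven_pattern_of_patterns:
  assumes "has_seven_pattern N \<or> has_six_pattern N \<or> has_five_pattern N \<or> has_four_pattern N \<or> has_three_pattern N"
  obtains t1 t2 t3 t4 t5 t6 t7 where
    "{t1, t2, t3, t4, t5, t6, t7} \<subseteq> N" "seven_pattern t1 t2 t3 t4 t5 t6 t7"
proof -
  \<comment> \<open>Each pattern arises from the next larger one by identifying two sets.\<close>
  have four: "four_pattern x y z z" if "three_pattern x y z" for x y z :: "'a set"
    using that by (auto simp: four_pattern_def three_pattern_def)
  have five: "five_pattern x y x w z" if "four_pattern x y z w" for x y z w :: "'a set"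
    using that by (auto simp: four_pattern_def five_pattern_def)
  have six: "six_pattern y x x p q z" if "five_pattern x y p q z" for x y p q z :: "'a set"
    using that by (auto simp: six_pattern_def five_pattern_def)
  have seven: "seven_pattern x x p c q r s" if "six_pattern x p c q r s" for x p c q r s :: "'a set"
    using that by (auto simp: six_pattern_def seven_pattern_def)
  from assms show thesis
  proof (elim disjE)
    assume "has_seven_pattern N"
    then obtain t1 t2 t3 t4 t5 t6 t7 where
      "{t1, t2, t3, t4, t5, t6, t7} \<subseteq> N" "seven_pattern t1 t2 t3 t4 t5 t6 t7"
      unfolding has_seven_pattern_def by (elim exE conjE) (rule that)
    then show thesis by (rule that)
  next
    assume "has_six_pattern N"
    then obtain x p c q r s where "{x, p, c, q, r, s} \<subseteq> N" "six_pattern x p c q r s"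
      unfolding has_six_pattern_def by (elim exE conjE) (rule that)
    with seven show thesis by (intro that[of x x p c q r s]) simp_all
  next
    assume "has_five_pattern N"
    then obtain x y p q z where "{x, y, p, q, z} \<subseteq> N" "five_pattern x y p q z"
      unfolding has_five_pattern_def by (elim exE conjE) (rule that)
    with seven[OF six] show thesis by (intro that[of y y x x p q z]) simp_all
  next
    assume "has_four_pattern N"
    then obtain x y z w where "{x, y, z, w} \<subseteq> N" "four_pattern x y z w"
      unfolding has_four_pattern_def by (elim exE conjE) (rule that)
    with seven[OF six[OF five]] show thesis by (intro that[of y y x x x w z]) simp_all
  next
    assume "has_three_pattern N"
    then obtain x y z where "{x, y, z} \<subseteq> N" "three_pattern x y z"
      unfolding has_three_pattern_def by (elim exE conjE) (rule that)
    with seven[OF six[OF five[OF four]]] show thesis by (intro that[of y y x x x z z]) simp_all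
  qed
qed

section \<open>Labellings of the Fano plane\<close>

text \<open>
The repetition occurs at two points \<open>A\<close>, \<open>B\<close>. Together with any point off their line they span
the plane, so in suitable coordinates it does not matter which two points they are.
\<close>

lemma six_pattern_of_repeated_label:
  assumes "projective_labelling 3 N \<tau>" "\<not> inj_on \<tau> (Pow {1..3} - {{}})"
  obtains x p c q r s where "{x, p, c, q, r, s} \<subseteq> N" "six_pattern x p c q r s"
proof -
  let ?pts = "Pow {1..3} - {{}} :: nat set set"
  obtain A B where A: "A \<in> ?pts" and B: "B \<in> ?pts" and "A \<noteq> B" and eq: "\<tau> A = \<tau> B"
    using assms(2) by (auto simp: inj_on_def)
  \<comment> \<open>A point off the line through \<open>A\<close> and \<open>B\<close> exists, since the plane has seven points
    and the line only three.\<close>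
  have "card {{}, A, B, sym_diff A B} \<le> 4"
    using card_length[of "[{}, A, B, sym_diff A B]"] by simp
  moreover have "card (Pow {1..3::nat}) = 8"
    by (simp add: card_Pow)
  ultimately have "\<not> Pow {1..3} \<subseteq> {{}, A, B, sym_diff A B}"
    using card_mono[of "{{}, A, B, sym_diff A B}" "Pow {1..3}"] by auto
  then obtain P where P: "P \<in> ?pts" "P \<noteq> A" "P \<noteq> B" "P \<noteq> sym_diff A B"
    by blast
  have mem: "sym_diff C D \<in> ?pts" if "C \<in> ?pts" "D \<in> ?pts" "C \<noteq> D" for C D
    using that by auto
  have line: "\<tau> C \<inter> \<tau> D \<inter> \<tau> E = {}"
    if "C \<in> ?pts" "D \<in> ?pts" "C \<noteq> D" "E = sym_diff C D" for C D E
    using assms(1) that by (auto simp: projective_labelling_def)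
  \<comment> \<open>The three points of the line are \<open>A\<close>, \<open>B\<close>, \<open>C\<close>; joining them to \<open>P\<close> yields the other three.\<close>
  define C where "C = sym_diff A B"
  define Q where "Q = sym_diff A P"
  define R where "R = sym_diff B P"
  define S where "S = sym_diff C P"
  have pts: "C \<in> ?pts" "Q \<in> ?pts" "R \<in> ?pts" "S \<in> ?pts"
    unfolding C_def Q_def R_def S_def by (intro mem A B P \<open>A \<noteq> B\<close> not_sym[OF P(2)] not_sym[OF P(3)] not_sym[OF P(4)])+
  have "\<tau> A \<inter> \<tau> C = {}"
    using line[OF A B \<open>A \<noteq> B\<close> C_def] eq by auto
  moreover have "\<tau> A \<inter> \<tau> P \<inter> \<tau> Q = {}"
    using line[OF A P(1) _ Q_def] P by auto
  moreover have "\<tau> A \<inter> \<tau> P \<inter> \<tau> R = {}"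
    using line[OF B P(1) _ R_def] P eq by auto
  moreover have "\<tau> A \<inter> \<tau> R \<inter> \<tau> S = {}"
  proof (rule line[OF A pts(3)])
    show "A \<noteq> R" using P by (auto simp: R_def)
    show "S = sym_diff A R" by (auto simp: R_def S_def C_def)
  qed
  moreover have "\<tau> A \<inter> \<tau> Q \<inter> \<tau> S = {}"
    unfolding eq
  proof (rule line[OF B pts(2)])
    show "B \<noteq> Q" using P by (auto simp: Q_def)
    show "S = sym_diff B Q" by (auto simp: Q_def S_def C_def)
  qed
  moreover have "\<tau> P \<inter> \<tau> C \<inter> \<tau> S = {}"
  proof (rule line[OF P(1) pts(1)])
    show "P \<noteq> C" using P by (simp add: C_def)
    show "S = sym_diff P C" by (auto simp: S_def)
  qed
  moreover have "\<tau> C \<inter> \<tau> Q \<inter> \<tau> R = {}"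
  proof (rule line[OF pts(1,2)])
    show "C \<noteq> Q" using P by (auto simp: C_def Q_def)
    show "R = sym_diff C Q" by (auto simp: C_def Q_def R_def)
  qed
  ultimately have "six_pattern (\<tau> A) (\<tau> P) (\<tau> C) (\<tau> Q) (\<tau> R) (\<tau> S)"
    unfolding six_pattern_def by blast
  moreover have "{\<tau> A, \<tau> P, \<tau> C, \<tau> Q, \<tau> R, \<tau> S} \<subseteq> N"
    using assms(1) A P(1) pts by (simp add: projective_labelling_def)
  ultimately show thesis
    by (rule that[rotated])
qed

lemma seven_pattern_of_labelling:
  assumes "projective_labelling 3 N \<tau>"
  shows "seven_pattern (\<tau> {1}) (\<tau> {2}) (\<tau> {3}) (\<tau> {1,2}) (\<tau> {1,3}) (\<tau> {2,3}) (\<tau> {1,2,3})"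
proof -
  have line: "\<tau> C \<inter> \<tau> D \<inter> \<tau> E = {}"
    if "C \<in> Pow {1..3} - {{}}" "D \<in> Pow {1..3} - {{}}" "C \<noteq> D" "E = sym_diff C D" for C D E
    using assms(1) that by (auto simp: projective_labelling_def)
  show ?thesis
    unfolding seven_pattern_def by (intro conjI line) auto
qed

lemma patterns_of_labelling:
  assumes "{} \<notin> N" "projective_labelling 3 N \<tau>"
  shows "has_seven_pattern N \<or> has_six_pattern N \<or> has_five_pattern N \<or> has_four_pattern N \<or> has_three_pattern N"
proof (cases "inj_on \<tau> (Pow {1..3} - {{}})")
  case True
  have "distinct (map (\<lambda>A. (1 \<in> A, 2 \<in> A, 3 \<in> A)) [{1}, {2}, {3}, {1,2}, {1,3}, {2,3}, {1,2,3::nat}])"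
    by simp
  then have "distinct [{1}, {2}, {3}, {1,2}, {1,3}, {2,3}, {1,2,3::nat}]"
    unfolding distinct_map by blast
  moreover have "set [{1}, {2}, {3}, {1,2}, {1,3}, {2,3}, {1,2,3}] \<subseteq> Pow {1..3::nat} - {{}}"
    by simp
  ultimately have "distinct (map \<tau> [{1}, {2}, {3}, {1,2}, {1,3}, {2,3}, {1,2,3}])"
    unfolding distinct_map using inj_on_subset[OF True] by blast
  moreover have "set (map \<tau> [{1}, {2}, {3}, {1,2}, {1,3}, {2,3}, {1,2,3}]) \<subseteq> N"
    using assms(2) by (auto simp: projective_labelling_def)
  ultimately show ?thesis
    using seven_pattern_of_labelling[OF assms(2)] unfolding has_seven_pattern_def list.map list.set
    by (intro disjI1 exI conjI)
next
  case False
  then obtain x p c q r s where "{x, p, c, q, r, s} \<subseteq> N" "six_pattern x p c q r s"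
    by (rule six_pattern_of_repeated_label[OF assms(2)])
  then show ?thesis
    by (intro disjI2 patterns_of_six_pattern[OF assms(1)])
qed

section \<open>Free tori of dimension at most three\<close>

lemma nonempty_subsets_1_2: "Pow {1..2::nat} - {{}} = {{1}, {2}, {1,2}}"
proof -
  have "{1..2::nat} = {1, 2}" by auto
  then show ?thesis by (auto simp: Pow_insert)
qed

lemma atLeastAtMost_1_3: "{1..3::nat} = {1, 2, 3}"
  by auto

lemma nonempty_subsets_1_3:
  "Pow {1..3::nat} - {{}} = {{1}, {2}, {3}, {1,2}, {1,3}, {2,3}, {1,2,3}}"
  unfolding atLeastAtMost_1_3 by (auto simp: Pow_insert)

text \<open>
The Fano plane has no blocking set: a set of points that meets every line contains a line. If no
\<open>v\<close> worked, \<open>P\<close> would meet every line, although by hypothesis it contains none.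
\<close>

lemma odd_transversal:
  assumes "\<not> (P {1} \<and> P {2} \<and> P {1,2})" "\<not> (P {1} \<and> P {3} \<and> P {1,3})"
    "\<not> (P {1} \<and> P {2,3} \<and> P {1,2,3})" "\<not> (P {2} \<and> P {3} \<and> P {2,3})"
    "\<not> (P {2} \<and> P {1,3} \<and> P {1,2,3})" "\<not> (P {3} \<and> P {1,2} \<and> P {1,2,3})"
    "\<not> (P {1,2} \<and> P {1,3} \<and> P {2,3})"
  shows "\<exists>v\<subseteq>{1..3::nat}. \<forall>A\<in>Pow {1..3} - {{}}. P A \<longrightarrow> odd (card (A \<inter> v))"
proof (rule ccontr)
  assume contra: "\<not> ?thesis"
  \<comment> \<open>For nonempty \<open>v\<close> the sets meeting \<open>v\<close> in an even number of elements form a line, so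
    the seven choices of \<open>v\<close> say that \<open>P\<close> has a point on every line.\<close>
  have even: "\<exists>A\<in>Pow {1..3} - {{}}. P A \<and> even (card (A \<inter> v))" if "v \<subseteq> {1..3}" for v
    using that contra by blast
  have "P {2} \<or> P {3} \<or> P {2,3}"
    using even[of "{1}"] unfolding nonempty_subsets_1_3 by auto
  moreover have "P {1} \<or> P {3} \<or> P {1,3}"
    using even[of "{2}"] unfolding nonempty_subsets_1_3 by auto
  moreover have "P {1} \<or> P {2} \<or> P {1,2}"
    using even[of "{3}"] unfolding nonempty_subsets_1_3 by auto
  moreover have "P {3} \<or> P {1,2} \<or> P {1,2,3}"
    using even[of "{1,2}"] unfolding nonempty_subsets_1_3 by auto
  moreover have "P {2} \<or> P {1,3} \<or> P {1,2,3}"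
    using even[of "{1,3}"] unfolding nonempty_subsets_1_3 by auto
  moreover have "P {1} \<or> P {2,3} \<or> P {1,2,3}"
    using even[of "{2,3}"] unfolding nonempty_subsets_1_3 by auto
  moreover have "P {1,2} \<or> P {1,3} \<or> P {2,3}"
    using even[of "{1,2,3}"] unfolding nonempty_subsets_1_3 by auto
  ultimately show False
    using assms by argo
qed

lemma free_torus_of_nonsimplex:
  assumes K: "abstract_simplicial_complex m K" and t: "t \<in> min_nonsimplices m K"
  shows "1 \<in> free_toric_dims m K"
proof (rule free_torus_of_odd_transversal[OF K, of _ "\<lambda>_. t" "\<lambda>_. {1}"])
  show "odd (card (A \<inter> {1}))" if "A \<in> Pow {1..1} - {{}}" for A :: "nat set"
  proof -
    have "A = {1}" using that by auto
    then show ?thesis by simp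
  qed
qed (use t in auto)

lemma free_torus_of_three_with_empty_intersection:
  assumes K: "abstract_simplicial_complex m K"
    and N: "{t1, t2, t3} \<subseteq> min_nonsimplices m K" and cond: "t1 \<inter> t2 \<inter> t3 = {}"
  shows "2 \<in> free_toric_dims m K"
proof -
  define \<tau> where "\<tau> A = (if A = {1} then t1 else if A = {2} then t2 else t3)" for A :: "nat set"
  have \<tau>: "\<tau> {1} = t1" "\<tau> {2} = t2" "\<tau> {1,2} = t3"
    by (simp_all add: \<tau>_def set_eq_subset)
  \<comment> \<open>Each \<open>i\<close> misses one of the three sets. The two labels that may contain \<open>i\<close> are
    those whose index meets the chosen \<open>v i\<close> in an odd number of elements.\<close>
  define v :: "nat \<Rightarrow> nat set"
    where "v i = (if i \<notin> t3 then {1,2} else if i \<notin> t1 then {2} else {1})" for i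
  show ?thesis
  proof (rule free_torus_of_odd_transversal[OF K])
    show "\<tau> A \<in> min_nonsimplices m K" if "A \<in> Pow {1..2} - {{}}" for A
      using that N unfolding nonempty_subsets_1_2
      by (auto simp: \<tau> simp del: One_nat_def)
    show "v i \<subseteq> {1..2}" for i
      by (auto simp: v_def)
    show "odd (card (A \<inter> v i))" if "A \<in> Pow {1..2} - {{}}" "i \<in> \<tau> A" for A i
      using that cond unfolding nonempty_subsets_1_2
      by (auto simp: \<tau> v_def simp del: One_nat_def split: if_splits)
  qed simp
qed

lemma free_torus_of_seven_pattern:
  assumes K: "abstract_simplicial_complex m K"
    and N: "{t1, t2, t3, t4, t5, t6, t7} \<subseteq> min_nonsimplices m K"
    and cond: "seven_pattern t1 t2 t3 t4 t5 t6 t7"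
  shows "3 \<in> free_toric_dims m K"
proof -
  define \<tau> where "\<tau> A =
    (if A = {1} then t1 else if A = {2} then t2 else if A = {3} then t3 else if A = {1,2} then t4
     else if A = {1,3} then t5 else if A = {2,3} then t6 else t7)" for A :: "nat set"
  have \<tau>: "\<tau> {1} = t1" "\<tau> {2} = t2" "\<tau> {3} = t3" "\<tau> {1,2} = t4" "\<tau> {1,3} = t5" "\<tau> {2,3} = t6"
    "\<tau> {1,2,3} = t7"
    by (simp_all add: \<tau>_def set_eq_subset)
  have "\<forall>i. \<exists>v\<subseteq>{1..3}. \<forall>A\<in>Pow {1..3} - {{}}. i \<in> \<tau> A \<longrightarrow> odd (card (A \<inter> v))"
    by (rule allI, rule odd_transversal; unfold \<tau>; use cond in \<open>unfold seven_pattern_def, blast\<close>)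
  from choice[OF this] obtain v where v:
    "\<forall>i. v i \<subseteq> {1..3} \<and> (\<forall>A\<in>Pow {1..3} - {{}}. i \<in> \<tau> A \<longrightarrow> odd (card (A \<inter> v i)))" ..
  show ?thesis
  proof (rule free_torus_of_odd_transversal[OF K order_refl])
    show "\<tau> A \<in> min_nonsimplices m K" if "A \<in> Pow {1..3} - {{}}" for A
      using that N unfolding nonempty_subsets_1_3
      by (auto simp: \<tau> simp del: One_nat_def)
    show "v i \<subseteq> {1..3}" for i
      using v by simp
    show "odd (card (A \<inter> v i))" if "A \<in> Pow {1..3} - {{}}" "i \<in> \<tau> A" for A i
      using v[rule_format, of i, THEN conjunct2] that by blast
  qed
qed

section \<open>The thresholds one, two and three\<close>

lemma one_le_buchstaber_invariant_iff:
  assumes K: "abstract_simplicial_complex m K"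
  shows "1 \<le> buchstaber_invariant m K \<longleftrightarrow> min_nonsimplices m K \<noteq> {}"
proof
  assume "1 \<le> buchstaber_invariant m K"
  then obtain \<tau> where "projective_labelling 1 (min_nonsimplices m K) \<tau>"
    using labelling_of_le_buchstaber_invariant[OF K] by blast
  then have "\<tau> {1} \<in> min_nonsimplices m K"
    unfolding projective_labelling_def by simp
  then show "min_nonsimplices m K \<noteq> {}" by blast
next
  assume "min_nonsimplices m K \<noteq> {}"
  then show "1 \<le> buchstaber_invariant m K"
    using free_torus_of_nonsimplex[OF K] le_buchstaber_invariant_iff by blast
qed

lemma two_le_buchstaber_invariant_iff:
  assumes K: "abstract_simplicial_complex m K"
  shows "2 \<le> buchstaber_invariant m K \<longleftrightarrow>
    (\<exists>t1 t2 t3. {t1, t2, t3} \<subseteq> min_nonsimplices m K \<and> t1 \<inter> t2 \<inter> t3 = {})"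
proof
  assume "2 \<le> buchstaber_invariant m K"
  then obtain \<tau> where \<tau>: "projective_labelling 2 (min_nonsimplices m K) \<tau>"
    using labelling_of_le_buchstaber_invariant[OF K] by blast
  have pts: "{1} \<in> Pow {1..2::nat} - {{}}" "{2} \<in> Pow {1..2::nat} - {{}}" "{1,2} \<in> Pow {1..2::nat} - {{}}"
    by auto
  have "sym_diff {1} {2} = {1, 2::nat}"
    by auto
  with projective_labelling_line[OF \<tau> pts(1,2)]
  have "\<tau> {1} \<inter> \<tau> {2} \<inter> \<tau> {1,2} = {}"
    by simp
  moreover have "{\<tau> {1}, \<tau> {2}, \<tau> {1,2}} \<subseteq> min_nonsimplices m K"
    using \<tau> pts by (simp add: projective_labelling_def)
  ultimately show "\<exists>t1 t2 t3. {t1, t2, t3} \<subseteq> min_nonsimplices m K \<and> t1 \<inter> t2 \<inter> t3 = {}"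
    by (intro exI conjI)
next
  assume "\<exists>t1 t2 t3. {t1, t2, t3} \<subseteq> min_nonsimplices m K \<and> t1 \<inter> t2 \<inter> t3 = {}"
  then have "2 \<in> free_toric_dims m K"
    by (elim exE conjE) (rule free_torus_of_three_with_empty_intersection[OF K])
  then show "2 \<le> buchstaber_invariant m K"
    using le_buchstaber_invariant_iff by blast
qed

lemma triple_or_disjoint_pair:
  assumes "{} \<notin> N"
  shows "(\<exists>t1 t2 t3. {t1, t2, t3} \<subseteq> N \<and> t1 \<inter> t2 \<inter> t3 = {}) \<longleftrightarrow>
    (\<exists>t1 t2 t3. distinct [t1, t2, t3] \<and> {t1, t2, t3} \<subseteq> N \<and> t1 \<inter> t2 \<inter> t3 = {}) \<or>
    (\<exists>t1 t2. distinct [t1, t2] \<and> {t1, t2} \<subseteq> N \<and> t1 \<inter> t2 = {})"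
    (is "?triple \<longleftrightarrow> ?distinct_triple \<or> ?pair")
proof
  have pair: ?pair if "x \<in> N" "y \<in> N" "x \<inter> y = {}" for x y
  proof (intro exI conjI)
    show "distinct [x, y]" using that assms by auto
  qed (use that in auto)
  assume ?triple
  then show "?distinct_triple \<or> ?pair"
  proof (elim exE conjE)
    fix t1 t2 t3 assume t: "{t1, t2, t3} \<subseteq> N" "t1 \<inter> t2 \<inter> t3 = {}"
    consider "distinct [t1, t2, t3]" | "t1 = t2" | "t1 = t3 \<or> t2 = t3"
      by auto
    then show ?thesis
    proof cases
      case 1
      with t have ?distinct_triple by (intro exI conjI)
      then show ?thesis ..
    next
      case 2
      with t pair[of t1 t3] have ?pair by simp
      then show ?thesis ..
    next
      case 3
      with t(2) have "t1 \<inter> t2 = {}" by auto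
      with t(1) pair[of t1 t2] have ?pair by simp
      then show ?thesis ..
    qed
  qed
next
  assume "?distinct_triple \<or> ?pair"
  then show ?triple
  proof (elim disjE exE conjE)
    fix t1 t2 t3 assume "{t1, t2, t3} \<subseteq> N" "t1 \<inter> t2 \<inter> t3 = {}"
    then show ?triple by (intro exI conjI)
  next
    fix t1 t2 assume "{t1, t2} \<subseteq> N" "t1 \<inter> t2 = {}"
    then have "{t1, t2, t2} \<subseteq> N" "t1 \<inter> t2 \<inter> t2 = {}"
      by auto
    then show ?triple by (intro exI conjI)
  qed
qed

lemma three_le_buchstaber_invariant_iff:
  assumes K: "abstract_simplicial_complex m K"
  defines "N \<equiv> min_nonsimplices m K"
  shows "3 \<le> buchstaber_invariant m K \<longleftrightarrow>
    has_seven_pattern N \<or> has_six_pattern N \<or> has_five_pattern N \<or> has_four_pattern N \<or> has_three_pattern N"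
proof
  assume "3 \<le> buchstaber_invariant m K"
  then obtain \<tau> where "projective_labelling 3 N \<tau>"
    using labelling_of_le_buchstaber_invariant[OF K] unfolding N_def by blast
  then show "has_seven_pattern N \<or> has_six_pattern N \<or> has_five_pattern N \<or> has_four_pattern N \<or> has_three_pattern N"
    using patterns_of_labelling empty_notin_min_nonsimplices[OF K] unfolding N_def by blast
next
  assume "has_seven_pattern N \<or> has_six_pattern N \<or> has_five_pattern N \<or> has_four_pattern N \<or> has_three_pattern N"
  then have "3 \<in> free_toric_dims m K"
    using free_torus_of_seven_pattern[OF K] unfolding N_def by (rule seven_pattern_of_patterns)
  then show "3 \<le> buchstaber_invariant m K"
    using le_buchstaber_invariant_iff by blast
qed

theorem theorem13:
  fixes m :: nat and K :: "nat set set"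
  assumes "abstract_simplicial_complex m K"
  shows
    "(buchstaber_invariant m K \<ge> 1 \<longleftrightarrow> min_nonsimplices m K \<noteq> {}) \<and>
     (min_nonsimplices m K \<noteq> {} \<longleftrightarrow> K \<noteq> Pow {1..m}) \<and>
     (buchstaber_invariant m K \<ge> 2 \<longleftrightarrow>
        (\<exists>t1 t2 t3. distinct [t1, t2, t3] \<and> {t1, t2, t3} \<subseteq> min_nonsimplices m K \<and>
           t1 \<inter> t2 \<inter> t3 = {}) \<or>
        (\<exists>t1 t2. distinct [t1, t2] \<and> {t1, t2} \<subseteq> min_nonsimplices m K \<and>
           t1 \<inter> t2 = {})) \<and>
     (buchstaber_invariant m K \<ge> 3 \<longleftrightarrow>
        (\<exists>t1 t2 t3 t4 t5 t6 t7. distinct [t1, t2, t3, t4, t5, t6, t7] \<and>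
           {t1, t2, t3, t4, t5, t6, t7} \<subseteq> min_nonsimplices m K \<and>
           t1 \<inter> t2 \<inter> t4 = {} \<and> t1 \<inter> t3 \<inter> t5 = {} \<and> t1 \<inter> t6 \<inter> t7 = {} \<and>
           t2 \<inter> t3 \<inter> t6 = {} \<and> t2 \<inter> t5 \<inter> t7 = {} \<and> t3 \<inter> t4 \<inter> t7 = {} \<and>
           t4 \<inter> t5 \<inter> t6 = {}) \<or>
        (\<exists>t1 t2 t3 t4 t5 t6. distinct [t1, t2, t3, t4, t5, t6] \<and>
           {t1, t2, t3, t4, t5, t6} \<subseteq> min_nonsimplices m K \<and>
           t1 \<inter> t3 = {} \<and> t1 \<inter> t2 \<inter> t4 = {} \<and> t1 \<inter> t2 \<inter> t5 = {} \<and>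
           t1 \<inter> t4 \<inter> t6 = {} \<and> t1 \<inter> t5 \<inter> t6 = {} \<and> t2 \<inter> t3 \<inter> t6 = {} \<and>
           t3 \<inter> t4 \<inter> t5 = {}) \<or>
        (\<exists>t1 t2 t3 t4 t5. distinct [t1, t2, t3, t4, t5] \<and>
           {t1, t2, t3, t4, t5} \<subseteq> min_nonsimplices m K \<and>
           t1 \<inter> t2 = {} \<and> t1 \<inter> t5 = {} \<and> t1 \<inter> t3 \<inter> t4 = {} \<and>
           t2 \<inter> t3 \<inter> t5 = {} \<and> t2 \<inter> t4 \<inter> t5 = {}) \<or>
        (\<exists>t1 t2 t3 t4. distinct [t1, t2, t3, t4] \<and>
           {t1, t2, t3, t4} \<subseteq> min_nonsimplices m K \<and>
           t1 \<inter> (t2 \<union> t3 \<union> t4) = {} \<and> t2 \<inter> t3 \<inter> t4 = {}) \<or>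
        (\<exists>t1 t2 t3. distinct [t1, t2, t3] \<and> {t1, t2, t3} \<subseteq> min_nonsimplices m K \<and>
           t1 \<inter> t2 = {} \<and> t1 \<inter> t3 = {} \<and> t2 \<inter> t3 = {}))"
proof -
  let ?N = "min_nonsimplices m K"
  have "{} \<notin> ?N"
    using assms by (rule empty_notin_min_nonsimplices)
  then show ?thesis
    unfolding one_le_buchstaber_invariant_iff[OF assms] two_le_buchstaber_invariant_iff[OF assms]
      three_le_buchstaber_invariant_iff[OF assms] triple_or_disjoint_pair[OF \<open>{} \<notin> ?N\<close>]
      min_nonsimplices_nonempty_iff[OF assms]
      has_seven_pattern_def has_six_pattern_def has_five_pattern_def has_four_pattern_def has_three_pattern_def
      seven_pattern_def six_pattern_def five_pattern_def four_pattern_def three_pattern_def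
    by (intro conjI refl)
qed

end
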